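(* Let $[ES]$ stand for either one of the two encodings $[ES2]$ or $[ES1]$ of braids on $3$ strands. (1) The column of alternating row sums $[ES][\pm]_{k\times 1}$ is a braid invariant; that is, if two braid words on $3$ strands, of lengths $k$ and $k'$, represent the same element of the braid group $B_3$, then the columns $[ES][\pm]_{k\times 1}$ and $[ES][\pm]_{k'\times 1}$ computed from their respective encodings are equal. (2) If a braid on $3$ strands of length $k$ is trivial, then $[ES][\pm]_{k\times 1}=[0]_{3\times 1}$, i.e. the alternating sum of each row of $[ES]$ is $0$.
   Context: A braid on $3$ strands of length $k\ge 0$ means a word $w=\sigma_{i_1}^{\varepsilon_1}\cdots\sigma_{i_k}^{\varepsilon_k}$ with $i_t\in\{1,2\}$, $\varepsilon_t\in\{1,-1\}$ (equivalently, the braid diagram it describes). Two braids are equal if they represent the same element of $B_3=\langle \sigma_1,\sigma_2\mid \sigma_1\sigma_2\sigma_1=\sigma_2\sigma_1\sigma_2\rangle$ (equivalently, they are related by second and third Reidemeister moves); a braid is trivial if it is equal to the empty braid. A property or quantity is a braid invariant if it takes the same value on equal braids. Crossings and strands: strands are labelled $1,2,3$ by their positions (top to bottom) at the left end. Put $a_0=(1,2,3)$ and let $a_t$ be obtained from $a_{t-1}$ by swapping the entries in positions $i_t$ and $i_t+1$. The $t$-th crossing involves the strands $p=a_{t-1}(i_t)$ and $q=a_{t-1}(i_t+1)$; if $\varepsilon_t=1$ then $p$ passes over $q$, and if $\varepsilon_t=-1$ then $q$ passes over $p$. Encoding $[ES2]$: the $3\times k$ matrix whose $t$-th column has entry $1$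 in the row indexed by the strand passing over at the $t$-th crossing, $-1$ in the row indexed by the strand passing under, and $0$ in the remaining row. Encoding $[ES1]$: the $3\times k$ matrix whose rows $1,2,3$ correspond to the ordered pairs of strands $(1,2)$, $(2,3)$, $(3,1)$ respectively; the $t$-th column has a single non-zero entry, in the row of the pair of strands crossing at the $t$-th crossing, equal to $1$ if the first strand of the ordered pair passes over the second and $-1$ if it passes under. $[\pm]_{k\times 1}$ is the column whose $t$-th entry is $(-1)^{t+1}$, so $M[\pm]_{k\times 1}$ is the column of alternating sums of rows of $M$ (zero if $k=0$). $[0]_{3\times 1}$ is the zero column. *)

theory Defs
  imports "Jordan_Normal_Form.Matrix" "HOL-Algebra.Group"
begin

datatype generator = Sigma1 | Sigma2

datatype exponent = Pos | Neg

type_synonym braid_word = "(generator \<times> exponent) list"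

fun neg :: "exponent \<Rightarrow> exponent" where
  "neg Pos = Neg"
| "neg Neg = Pos"

text \<open>
  The group with generators \<open>Sigma1\<close>, \<open>Sigma2\<close> and the single relation
  \<open>Sigma1 Sigma2 Sigma1 = Sigma2 Sigma1 Sigma2\<close> consists of the words modulo the least
  congruence for concatenation that contains the cancellation of adjacent inverse
  letters and the relation.
\<close>

inductive word_equiv :: "braid_word \<Rightarrow> braid_word \<Rightarrow> bool" where
  refl: "word_equiv w w"
| sym: "word_equiv v w \<Longrightarrow> word_equiv w v"
| trans: "word_equiv u v \<Longrightarrow> word_equiv v w \<Longrightarrow> word_equiv u w"
| cancel: "word_equiv (u @ [(g, e), (g, neg e)] @ v) (u @ v)"
| braid: "word_equiv (u @ [(Sigma1, Pos), (Sigma2, Pos), (Sigma1, Pos)] @ v)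
                     (u @ [(Sigma2, Pos), (Sigma1, Pos), (Sigma2, Pos)] @ v)"

definition word_rel :: "braid_word rel" where
  "word_rel = {(v, w). word_equiv v w}"

definition braid_of :: "braid_word \<Rightarrow> braid_word set" where
  "braid_of w = word_rel `` {w}"

definition B3 :: "braid_word set monoid" where
  "B3 = \<lparr>carrier = UNIV // word_rel,
         mult = (\<lambda>A B. \<Union>u\<in>A. \<Union>v\<in>B. braid_of (u @ v)),
         one = braid_of []\<rparr>"

definition braid_equal :: "braid_word \<Rightarrow> braid_word \<Rightarrow> bool" where
  "braid_equal v w \<longleftrightarrow> braid_of v = braid_of w"

definition trivial_braid :: "braid_word \<Rightarrow> bool" where
  "trivial_braid w \<longleftrightarrow> braid_equal w []"

lemma equiv_word_rel: "equiv UNIV word_rel"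
proof (rule equivI)
  show "sym word_rel" by (auto simp: word_rel_def intro!: symI dest: word_equiv.sym)
  show "trans word_rel" by (rule transI) (simp add: word_rel_def, rule word_equiv.trans)
qed (auto simp: word_rel_def refl_on_def intro: word_equiv.refl)

lemma braid_of_eq_iff: "braid_of v = braid_of w \<longleftrightarrow> word_equiv v w"
  unfolding braid_of_def
  using eq_equiv_class_iff[OF equiv_word_rel, of v w] by (simp add: word_rel_def)

lemma mem_braid_of: "v \<in> braid_of w \<longleftrightarrow> word_equiv w v"
  by (simp add: braid_of_def word_rel_def)

lemma carrier_B3: "carrier B3 = range braid_of"
  by (auto simp: B3_def quotient_def braid_of_def)

lemma word_equiv_context: "word_equiv v w \<Longrightarrow> word_equiv (a @ v @ b) (a @ w @ b)"
proof (induction rule: word_equiv.induct)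
  case (cancel u g e v)
  then show ?case using word_equiv.cancel[of "a @ u" g e "v @ b"] by simp
next
  case (braid u v)
  then show ?case using word_equiv.braid[of "a @ u" "v @ b"] by simp
next
  case (sym v w)
  show ?case by (rule word_equiv.sym[OF sym.IH])
next
  case (trans u v w)
  show ?case by (rule word_equiv.trans[OF trans.IH])
qed (rule word_equiv.refl)

lemma word_equiv_append:
  "word_equiv u u' \<Longrightarrow> word_equiv v v' \<Longrightarrow> word_equiv (u @ v) (u' @ v')"
  using word_equiv.trans[of "u @ v" "u' @ v" "u' @ v'"]
    word_equiv_context[of u u' "[]" v] word_equiv_context[of v v' u' "[]"]
  by simp

lemma mult_B3 [simp]: "braid_of u \<otimes>\<^bsub>B3\<^esub> braid_of v = braid_of (u @ v)"
proof -
  have same: "braid_of (u' @ v') = braid_of (u @ v)"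
    if "u' \<in> braid_of u" "v' \<in> braid_of v" for u' v'
  proof -
    have "word_equiv (u @ v) (u' @ v')"
      using that unfolding mem_braid_of by (rule word_equiv_append)
    then show ?thesis unfolding braid_of_eq_iff by (rule word_equiv.sym)
  qed
  have "u \<in> braid_of u" "v \<in> braid_of v"
    unfolding mem_braid_of by (rule word_equiv.refl)+
  have "braid_of u \<otimes>\<^bsub>B3\<^esub> braid_of v = (\<Union>u'\<in>braid_of u. \<Union>v'\<in>braid_of v. braid_of (u' @ v'))"
    by (simp add: B3_def)
  also have "\<dots> = (\<Union>u'\<in>braid_of u. \<Union>v'\<in>braid_of v. braid_of (u @ v))"
    by (intro SUP_cong HOL.refl same)
  also have "\<dots> = braid_of (u @ v)"
    using \<open>u \<in> braid_of u\<close> \<open>v \<in> braid_of v\<close> by blast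
  finally show ?thesis .
qed

lemma neg_neg [simp]: "neg (neg e) = e"
  by (cases e) auto

lemma word_equiv_inverse:
  "word_equiv (rev (map (\<lambda>(g, e). (g, neg e)) w) @ w) []"
proof (induction w)
  case (Cons a w)
  obtain g e where a: "a = (g, e)" by force
  show ?case
    using word_equiv.trans[OF word_equiv.cancel[of "rev (map (\<lambda>(g, e). (g, neg e)) w)" g "neg e" w] Cons]
    by (simp add: a)
qed (simp add: word_equiv.refl)

lemma group_B3: "group B3"
proof (rule groupI)
  fix A assume "A \<in> carrier B3"
  then obtain w where w: "A = braid_of w" unfolding carrier_B3 by (elim rangeE)
  let ?B = "braid_of (rev (map (\<lambda>(g, e). (g, neg e)) w))"
  have "?B \<otimes>\<^bsub>B3\<^esub> A = \<one>\<^bsub>B3\<^esub>"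
    unfolding w mult_B3 using word_equiv_inverse[of w] by (simp add: B3_def braid_of_eq_iff)
  moreover have "?B \<in> carrier B3" unfolding carrier_B3 by (rule rangeI)
  ultimately show "\<exists>B\<in>carrier B3. B \<otimes>\<^bsub>B3\<^esub> A = \<one>\<^bsub>B3\<^esub>" by (rule bexI)
next
  have one: "\<one>\<^bsub>B3\<^esub> = braid_of []" by (simp add: B3_def)
  show "\<one>\<^bsub>B3\<^esub> \<in> carrier B3" by (simp add: one carrier_B3)
  show "\<one>\<^bsub>B3\<^esub> \<otimes>\<^bsub>B3\<^esub> A = A" if "A \<in> carrier B3" for A
    using that by (auto simp: one carrier_B3)
next
  fix A B assume "A \<in> carrier B3" "B \<in> carrier B3"
  then show "A \<otimes>\<^bsub>B3\<^esub> B \<in> carrier B3" by (auto simp: carrier_B3)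
next
  fix A B C assume "A \<in> carrier B3" "B \<in> carrier B3" "C \<in> carrier B3"
  then show "A \<otimes>\<^bsub>B3\<^esub> B \<otimes>\<^bsub>B3\<^esub> C = A \<otimes>\<^bsub>B3\<^esub> (B \<otimes>\<^bsub>B3\<^esub> C)"
    by (auto simp: carrier_B3)
qed

text \<open>No identifications beyond those forced by the relation: evaluating words at any two
  group elements that satisfy it is well defined on braids.\<close>

fun word_eval :: "('a, 'b) monoid_scheme \<Rightarrow> (generator \<Rightarrow> 'a) \<Rightarrow> braid_word \<Rightarrow> 'a" where
  "word_eval G f [] = \<one>\<^bsub>G\<^esub>"
| "word_eval G f ((g, Pos) # w) = f g \<otimes>\<^bsub>G\<^esub> word_eval G f w"
| "word_eval G f ((g, Neg) # w) = inv\<^bsub>G\<^esub> (f g) \<otimes>\<^bsub>G\<^esub> word_eval G f w"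

lemma word_eval_braid_equal:
  assumes G: "group G" and f: "\<And>g. f g \<in> carrier G"
    and rel: "f Sigma1 \<otimes>\<^bsub>G\<^esub> f Sigma2 \<otimes>\<^bsub>G\<^esub> f Sigma1 = f Sigma2 \<otimes>\<^bsub>G\<^esub> f Sigma1 \<otimes>\<^bsub>G\<^esub> f Sigma2"
    and "braid_equal v w"
  shows "word_eval G f v = word_eval G f w"
proof -
  interpret group G by (rule G)
  have closed [simp]: "word_eval G f u \<in> carrier G" for u
  proof (induction u)
    case (Cons a u)
    obtain g e where "a = (g, e)" by force
    with Cons f show ?case by (cases e) simp_all
  qed simp
  have app: "word_eval G f (u @ v) = word_eval G f u \<otimes>\<^bsub>G\<^esub> word_eval G f v" for u v
  proof (induction u)
    case (Cons a u)
    obtain g e where "a = (g, e)" by force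
    with Cons f show ?case by (cases e) (simp_all add: m_assoc)
  qed simp
  have "word_eval G f v = word_eval G f w" if "word_equiv v w"
    using that
  proof (induction rule: word_equiv.induct)
    case (cancel u g e v)
    then show ?case by (cases e) (simp_all add: app f m_assoc[symmetric])
  next
    case (braid u v)
    have "f Sigma1 \<otimes>\<^bsub>G\<^esub> (f Sigma2 \<otimes>\<^bsub>G\<^esub> (f Sigma1 \<otimes>\<^bsub>G\<^esub> x))
        = f Sigma2 \<otimes>\<^bsub>G\<^esub> (f Sigma1 \<otimes>\<^bsub>G\<^esub> (f Sigma2 \<otimes>\<^bsub>G\<^esub> x))" if "x \<in> carrier G" for x
      using rel that by (simp add: f m_assoc[symmetric])
    then show ?case by (simp add: app)
  qed auto
  then show ?thesis using assms(4) by (simp add: braid_equal_def braid_of_eq_iff)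
qed

text \<open>Strands and positions are numbered 1, 2, 3, whereas list and matrix indices start
  at 0: the \<open>t\<close>-th crossing is \<open>w ! (t - 1)\<close> and corresponds to column \<open>t - 1\<close>.\<close>

fun position :: "generator \<Rightarrow> nat" where
  "position Sigma1 = 1"
| "position Sigma2 = 2"

text \<open>\<open>arrangement w t i\<close> is the strand in position \<open>i\<close> after the first \<open>t\<close> crossings
  (for \<open>t \<le> length w\<close>, \<open>i \<in> {1, 2, 3}\<close>).\<close>

primrec arrangement :: "braid_word \<Rightarrow> nat \<Rightarrow> nat \<Rightarrow> nat" where
  "arrangement w 0 = (\<lambda>i. i)"
| "arrangement w (Suc t) =
     (let a = arrangement w t; i = position (fst (w ! t))
      in a(i := a (i + 1), i + 1 := a i))"

definition over_strand :: "braid_word \<Rightarrow> nat \<Rightarrow> nat" where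
  "over_strand w j =
     (let i = position (fst (w ! j)); p = arrangement w j i; q = arrangement w j (i + 1)
      in case snd (w ! j) of Pos \<Rightarrow> p | Neg \<Rightarrow> q)"

definition under_strand :: "braid_word \<Rightarrow> nat \<Rightarrow> nat" where
  "under_strand w j =
     (let i = position (fst (w ! j)); p = arrangement w j i; q = arrangement w j (i + 1)
      in case snd (w ! j) of Pos \<Rightarrow> q | Neg \<Rightarrow> p)"

definition ES2 :: "braid_word \<Rightarrow> int mat" where
  "ES2 w = mat 3 (length w) (\<lambda>(r, j).
     if over_strand w j = r + 1 then 1
     else if under_strand w j = r + 1 then -1 else 0)"

definition row_pair :: "nat \<Rightarrow> nat \<times> nat" where
  "row_pair r = [(1, 2), (2, 3), (3, 1)] ! r"

definition ES1 :: "braid_word \<Rightarrow> int mat" where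
  "ES1 w = mat 3 (length w) (\<lambda>(r, j).
     if row_pair r = (over_strand w j, under_strand w j) then 1
     else if row_pair r = (under_strand w j, over_strand w j) then -1 else 0)"

text \<open>With indices starting at 0, the sign \<open>(-1)^(t+1)\<close> of the \<open>t\<close>-th entry becomes
  \<open>(-1)^j\<close> for \<open>j = t - 1\<close>.\<close>

definition alt_col :: "nat \<Rightarrow> int mat" where
  "alt_col k = mat k 1 (\<lambda>(j, _). (-1) ^ j)"

end

theory Submission
  imports Defs
begin

text \<open>
  In both encodings each entry of a column is a function \<open>f\<close> of the ordered pair
  (strand passing over, strand passing under) of the corresponding crossing. The alternating
  sum of \<open>f\<close> over the crossings is a braid invariant for \<^emph>\<open>every\<close> such \<open>f\<close>, so one argument serves
  all rows of both encodings.

  The reason is local. When \<open>\<sigma>\<close> is followed by its inverse, the same strand passes over the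
  same other strand at both crossings; as the two crossings are adjacent, they have opposite signs in
  the sum and cancel. If the strands \<open>p\<close>, \<open>q\<close>, \<open>r\<close> enter a third Reidemeister move in
  positions 1, 2, 3, then the two sides have the crossings \<open>pq\<close>, \<open>pr\<close>, \<open>qr\<close> and
  \<open>qr\<close>, \<open>pr\<close>, \<open>pq\<close> (first strand over). The order is reversed, and since the
  number of crossings is odd, reversal preserves the alternating signs. Both moves change the length
  by an even number and do not change how the strands leave the modified piece, so the rest of the
  word contributes the same amount as before.

  To make this locality available, the sum is defined by recursion on the word, starting from an
  arbitrary arrangement of the strands. The lemma \<open>alternating_sum_append\<close> then isolates a piece of
  a word, and \<open>alternating_sum_word_equiv\<close> is the invariance.
\<close>

definition swap_strands :: "generator \<Rightarrow> (nat \<Rightarrow> nat) \<Rightarrow> nat \<Rightarrow> nat" where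
  "swap_strands g a = a(position g := a (position g + 1), position g + 1 := a (position g))"

abbreviation final_arrangement :: "(nat \<Rightarrow> nat) \<Rightarrow> braid_word \<Rightarrow> nat \<Rightarrow> nat" where
  "final_arrangement a w \<equiv> fold (\<lambda>x. swap_strands (fst x)) w a"

definition over_under :: "(nat \<Rightarrow> nat) \<Rightarrow> generator \<times> exponent \<Rightarrow> nat \<times> nat" where
  "over_under a x =
     (let p = a (position (fst x)); q = a (position (fst x) + 1)
      in case snd x of Pos \<Rightarrow> (p, q) | Neg \<Rightarrow> (q, p))"

primrec alternating_sum :: "(nat \<times> nat \<Rightarrow> int) \<Rightarrow> (nat \<Rightarrow> nat) \<Rightarrow> braid_word \<Rightarrow> int" where
  "alternating_sum f a [] = 0"
| "alternating_sum f a (x # w) =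
     f (over_under a x) - alternating_sum f (swap_strands (fst x) a) w"

lemma alternating_sum_append:
  "alternating_sum f a (u @ v) =
     alternating_sum f a u + (-1) ^ length u * alternating_sum f (final_arrangement a u) v"
  by (induction u arbitrary: a) auto

lemma swap_strands_twice [simp]: "swap_strands g (swap_strands g a) = a"
  by (auto simp: swap_strands_def)

text \<open>The inverse letter meets the two strands in exchanged positions, which compensates its
  exchange of over and under.\<close>

lemma over_under_inverse_letter:
  "over_under (swap_strands g a) (g, neg e) = over_under a (g, e)"
  by (cases e) (auto simp: over_under_def swap_strands_def)

lemma swap_strands_braid_relation:
  "swap_strands Sigma1 (swap_strands Sigma2 (swap_strands Sigma1 a)) =
   swap_strands Sigma2 (swap_strands Sigma1 (swap_strands Sigma2 a))"
  by (rule ext) (simp add: swap_strands_def numeral_eq_Suc)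

text \<open>Both sides equal \<open>f (p, q) - f (p, r) + f (q, r)\<close>, where \<open>p\<close>, \<open>q\<close>, \<open>r\<close>
  are the strands in positions 1, 2, 3: the middle crossing is common to both sides, and the
  outer two, which have the same sign, are exchanged.\<close>

lemma alternating_sum_braid_relation:
  "alternating_sum f a [(Sigma1, Pos), (Sigma2, Pos), (Sigma1, Pos)] =
   alternating_sum f a [(Sigma2, Pos), (Sigma1, Pos), (Sigma2, Pos)]"
  by (simp add: over_under_def swap_strands_def numeral_eq_Suc)

lemma alternating_sum_word_equiv:
  "word_equiv v w \<Longrightarrow> alternating_sum f a v = alternating_sum f a w"
proof (induction rule: word_equiv.induct)
  case (cancel u g e v)
  show ?case by (simp add: alternating_sum_append over_under_inverse_letter)
next
  case (braid u v)
  let ?l = "[(Sigma1, Pos), (Sigma2, Pos), (Sigma1, Pos)]"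
  let ?r = "[(Sigma2, Pos), (Sigma1, Pos), (Sigma2, Pos)]"
  have "final_arrangement b ?l = final_arrangement b ?r" for b
    by (simp add: swap_strands_braid_relation)
  moreover have "length ?l = length ?r" by simp
  ultimately show ?case
    by (simp only: alternating_sum_append alternating_sum_braid_relation)
qed auto

lemma alternating_sum_eq_sum:
  "alternating_sum f a w =
     (\<Sum>j<length w. f (over_under (final_arrangement a (take j w)) (w ! j)) * (-1) ^ j)"
proof (induction w arbitrary: a)
  case (Cons x w)
  then show ?case by (simp add: sum.lessThan_Suc_shift sum_negf del: sum.lessThan_Suc)
qed simp

lemma arrangement_eq_final_arrangement:
  "t \<le> length w \<Longrightarrow> arrangement w t = final_arrangement (\<lambda>i. i) (take t w)"
  by (induction t) (simp_all add: take_Suc_conv_app_nth swap_strands_def Let_def)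

lemma over_under_strand:
  assumes "j < length w"
  shows "(over_strand w j, under_strand w j) =
           over_under (final_arrangement (\<lambda>i. i) (take j w)) (w ! j)"
  using assms
  by (simp add: over_strand_def under_strand_def over_under_def Let_def
      arrangement_eq_final_arrangement split: exponent.split)

lemma encoding_times_alt_col:
  fixes f :: "nat \<Rightarrow> nat \<times> nat \<Rightarrow> int"
  shows "mat n (length w) (\<lambda>(r, j). f r (over_strand w j, under_strand w j)) * alt_col (length w)
       = mat n 1 (\<lambda>(r, _). alternating_sum (f r) (\<lambda>i. i) w)"
  by (rule eq_matI)
    (auto simp: alt_col_def scalar_prod_def alternating_sum_eq_sum over_under_strand lessThan_atLeast0)

text \<open>The common form of the two encodings through which the invariance of \<open>alternating_sum\<close>
  applies to both.\<close>

lemma encoding_by_over_under: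
  assumes "ES = ES2 \<or> ES = ES1"
  obtains f :: "nat \<Rightarrow> nat \<times> nat \<Rightarrow> int"
  where "\<And>w. ES w = mat 3 (length w) (\<lambda>(r, j). f r (over_strand w j, under_strand w j))"
  using assms
proof
  assume "ES = ES2"
  then show thesis
    using that[of "\<lambda>r (p, q). if p = r + 1 then 1 else if q = r + 1 then -1 else 0"]
    by (simp add: ES2_def)
next
  assume "ES = ES1"
  then show thesis
    using that[of "\<lambda>r (p, q). if row_pair r = (p, q) then 1 else if row_pair r = (q, p) then -1 else 0"]
    by (simp add: ES1_def)
qed

theorem theorem1:
  fixes ES :: "braid_word \<Rightarrow> int mat"
  assumes "ES = ES2 \<or> ES = ES1"
  shows "(\<forall>w w'. braid_equal w w' \<longrightarrow>
             ES w * alt_col (length w) = ES w' * alt_col (length w'))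
       \<and> (\<forall>w. trivial_braid w \<longrightarrow> ES w * alt_col (length w) = 0\<^sub>m 3 1)"
proof -
  obtain f :: "nat \<Rightarrow> nat \<times> nat \<Rightarrow> int"
    where "\<And>w. ES w = mat 3 (length w) (\<lambda>(r, j). f r (over_strand w j, under_strand w j))"
    using encoding_by_over_under[OF assms] by blast
  then have column: "ES w * alt_col (length w) = mat 3 1 (\<lambda>(r, _). alternating_sum (f r) (\<lambda>i. i) w)" for w
    by (simp only: encoding_times_alt_col)
  have invariant: "ES w * alt_col (length w) = ES w' * alt_col (length w')" if "braid_equal w w'" for w w'
  proof -
    have "word_equiv w w'" using that by (simp add: braid_equal_def braid_of_eq_iff)
    then have "alternating_sum (f r) (\<lambda>i. i) w = alternating_sum (f r) (\<lambda>i. i) w'" for r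
      by (rule alternating_sum_word_equiv)
    then show ?thesis by (simp only: column)
  qed
  moreover have "ES w * alt_col (length w) = 0\<^sub>m 3 1" if "trivial_braid w" for w
  proof -
    have "ES w * alt_col (length w) = ES [] * alt_col (length ([] :: braid_word))"
      using that unfolding trivial_braid_def by (rule invariant)
    also have "\<dots> = 0\<^sub>m 3 1"
      by (simp only: column alternating_sum.simps) auto
    finally show ?thesis .
  qed
  ultimately show ?thesis by blast
qed

end
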